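(* Let $\mathcal{S}$ be an idempotent commutative semiring which satisfies the Presburger property and whose natural order is a total order. Let $\mathcal{X},\mathcal{Y}\subset\mathcal{S}^n$, $\mathcal{Z}\subset\mathcal{S}^p$, $\mathcal{G}\subset\mathcal{S}^{n+p}$ and $\mathcal{W}\subset(\mathcal{S}^n)^2$ be rational semimodules, and let $A:\mathcal{S}^n\to\mathcal{S}^p$ be a linear map. Then the following sets are all rational semimodules: (1) $\mathcal{X}\cap\mathcal{Y}$; (2) $\mathcal{X}\mathcal{G}=\{v\in\mathcal{S}^p\mid\exists x\in\mathcal{X},\,(x,v)\in\mathcal{G}\}$ and $\mathcal{G}\mathcal{Z}=\{u\in\mathcal{S}^n\mid\exists z\in\mathcal{Z},\,(u,z)\in\mathcal{G}\}$; (3) $A\mathcal{X}=\{Ax\mid x\in\mathcal{X}\}$; (4) $A^{-1}\mathcal{Z}=\{x\in\mathcal{S}^n\mid Ax\in\mathcal{Z}\}$; (5) $\mathcal{X}\ominus\mathcal{Y}=\{u\in\mathcal{S}^n\mid\exists y\in\mathcal{Y},\,u\oplus y\in\mathcal{X}\}$; (6) $\mathcal{W}^\perp=\{x\in\mathcal{S}^n\mid a\cdot x=b\cdot x\ \ \forall(a,b)\in\mathcal{W}\}$, where $a\cdot x=\bigoplus_{1\le i\le n}a_i\otimes x_i$; (7) $\mathcal{X}^\top=\{(a,b)\in(\mathcal{S}^n)^2\mid a\cdot x=b\cdot x\ \ \forall x\in\mathcal{X}\}$.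
   Context: A semiring $(\mathcal{S},\oplus,\otimes,\varepsilon,e)$ has a commutative monoid addition $\oplus$ with neutral element $\varepsilon$, a monoid multiplication $\otimes$ with neutral element $e$, multiplication distributes over addition, and $\varepsilon$ is absorbing for $\otimes$. It is idempotent if $x\oplus x=x$ for all $x$; the natural order is then $x\preceq y\iff x\oplus y=y$. The free semimodule $\mathcal{S}^n$ has entrywise addition and left action $(\lambda x)_i=\lambda\otimes x_i$. A subsemimodule of $\mathcal{S}^n$ is a (nonempty) subset $\mathcal{Z}$ with $\lambda x\oplus\mu y\in\mathcal{Z}$ for all $x,y\in\mathcal{Z}$, $\lambda,\mu\in\mathcal{S}$. For $G\subset\mathcal{S}^n$, $\mathrm{span}\,G$ is the subsemimodule generated by $G$, i.e. the set of finite linear combinations $\bigoplus_{i=1}^k\lambda_iu^i$ with $u^i\in G$, $\lambda_i\in\mathcal{S}$ (an empty sum is the zero vector). A linear map is a map preserving $\oplus$, the zero and the action of $\mathcal{S}$. $\mathcal{S}^{n+p}$ is identified with $\mathcal{S}^n\times\mathcal{S}^p$ and $(\mathcal{S}^n)^2$ with $\mathcal{S}^{2n}$. The class of rational subsets of a monoid $(M,\cdot)$ with unit $1_M$ is the least class of subsets of $M$ that contains all finite subsets and is closed under union, product $U\cdot V=\{u\cdot v\mid u\in U,v\in V\}$, and star $U^*=U^0\cup U\cup U^2\cup\cdots$, where $U^0=\{1_M\}$. A subsemimodule $\mathcal{X}\subset\mathcal{S}^n$ is rational ("a rational semimodule") if $\mathcal{X}=\mathrm{span}\,G$ for some rational subset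 $G$ of the monoid $(\mathcal{S}^n,\otimes)$, where $\otimes$ is the entrywise product. Presburger property. The first-order logic formulas of $(\mathcal{S},e,\otimes,\preceq)$ form the smallest class $\mathcal{P}$ of formulas such that: for all nonnegative integers $k_i,r_i$, $\bigotimes_{i=1}^n x_i^{k_i}\preceq\bigotimes_{j=1}^n x_j^{r_j}$ is in $\mathcal{P}$ with free variables $x_1,\dots,x_n$ (with $x_i^0=e$); $\mathcal{P}$ is closed under conjunction, disjunction, negation; and $\mathcal{P}$ is closed under existential quantification $(\exists x_i)$ of a free variable (ranging over $\mathcal{S}$). A subset $D\subset\mathcal{S}^n$ is definable if $D=\{(x_1,\dots,x_n)\in\mathcal{S}^n\mid P(x_1,\dots,x_n)\text{ is true}\}$ for some $P\in\mathcal{P}$ with free variables $x_1,\dots,x_n$. $\mathcal{S}$ has the Presburger property if, for every $n$, the definable subsets of $\mathcal{S}^n$ are precisely the rational subsets of $(\mathcal{S}^n,\otimes)$. *)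

theory Defs
  imports "HOL-Algebra.Coset" "Jordan_Normal_Form.Matrix"
begin

text \<open>
  A commutative semiring is a type of sort \<open>{comm_semiring_0, comm_monoid_mult}\<close>. This is
  \<open>comm_semiring_1\<close> without the axiom \<open>0 \<noteq> 1\<close>, which is not part of the semiring axioms.
  The semimodule of vectors of length \<open>n\<close> is \<open>carrier_vec n\<close>, and a pair \<open>(x, v)\<close> of vectors is
  identified with the concatenation \<open>x @\<^sub>v v\<close>.
\<close>

definition natural_le :: "'a::plus \<Rightarrow> 'a \<Rightarrow> bool" (infix \<open>\<preceq>\<close> 50)
  where "x \<preceq> y \<longleftrightarrow> x + y = y"

definition subsemimodule :: "nat \<Rightarrow> 'a::{comm_semiring_0,comm_monoid_mult} vec set \<Rightarrow> bool"
  where "subsemimodule n Z \<longleftrightarrow>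
    Z \<subseteq> carrier_vec n \<and> Z \<noteq> {} \<and>
    (\<forall>x\<in>Z. \<forall>y\<in>Z. \<forall>l m. l \<cdot>\<^sub>v x + m \<cdot>\<^sub>v y \<in> Z)"

text \<open>The case \<open>k = 0\<close> contributes the zero vector.\<close>

definition semimodule_span ::
    "nat \<Rightarrow> 'a::{comm_semiring_0,comm_monoid_mult} vec set \<Rightarrow> 'a vec set"
  where "semimodule_span n G =
    {vec n (\<lambda>i. \<Sum>j<k. (c j \<cdot>\<^sub>v u j) $ i) | (k::nat) c u. \<forall>j<k. u j \<in> G}"

definition semimodule_hom ::
    "nat \<Rightarrow> nat \<Rightarrow> ('a::{comm_semiring_0,comm_monoid_mult} vec \<Rightarrow> 'a vec) \<Rightarrow> bool"
  where "semimodule_hom n p A \<longleftrightarrow>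
    A \<in> carrier_vec n \<rightarrow> carrier_vec p \<and>
    (\<forall>x\<in>carrier_vec n. \<forall>y\<in>carrier_vec n. A (x + y) = A x + A y) \<and>
    A (0\<^sub>v n) = 0\<^sub>v p \<and>
    (\<forall>l. \<forall>x\<in>carrier_vec n. A (l \<cdot>\<^sub>v x) = l \<cdot>\<^sub>v A x)"


primrec set_power :: "('m, 'b) monoid_scheme \<Rightarrow> 'm set \<Rightarrow> nat \<Rightarrow> 'm set"
  where
    "set_power M U 0 = {\<one>\<^bsub>M\<^esub>}"
  | "set_power M U (Suc k) = set_power M U k <#>\<^bsub>M\<^esub> U"

inductive rational_subset :: "('m, 'b) monoid_scheme \<Rightarrow> 'm set \<Rightarrow> bool"
  for M :: "('m, 'b) monoid_scheme"
  where
    finite: "finite F \<Longrightarrow> F \<subseteq> carrier M \<Longrightarrow> rational_subset M F"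
  | union: "rational_subset M U \<Longrightarrow> rational_subset M V \<Longrightarrow> rational_subset M (U \<union> V)"
  | product: "rational_subset M U \<Longrightarrow> rational_subset M V \<Longrightarrow> rational_subset M (U <#>\<^bsub>M\<^esub> V)"
  | star: "rational_subset M U \<Longrightarrow> rational_subset M (\<Union>k. set_power M U k)"

definition entrywise_monoid :: "nat \<Rightarrow> 'a::{comm_semiring_0,comm_monoid_mult} vec monoid"
  where "entrywise_monoid n =
    \<lparr>carrier = carrier_vec n, monoid.mult = component_mult, one = vec n (\<lambda>_. 1)\<rparr>"

definition rational_semimodule :: "nat \<Rightarrow> 'a::{comm_semiring_0,comm_monoid_mult} vec set \<Rightarrow> bool"
  where "rational_semimodule n X \<longleftrightarrow>
    subsemimodule n X \<and>
    (\<exists>G. rational_subset (entrywise_monoid n) G \<and> X = semimodule_span n G)"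


text \<open>
  \<open>FMonomialLe n k r\<close> is the atomic formula with free variables \<open>x\<^sub>0, \<dots>, x\<^sub>n\<^sub>-\<^sub>1\<close> comparing the
  monomials with exponents \<open>k\<close> and \<open>r\<close>. A variable with exponent 0 still counts as free.
\<close>

datatype fo_formula =
    FMonomialLe nat "nat \<Rightarrow> nat" "nat \<Rightarrow> nat"
  | FAnd fo_formula fo_formula
  | FOr fo_formula fo_formula
  | FNot fo_formula
  | FEx nat fo_formula

primrec free_vars :: "fo_formula \<Rightarrow> nat set"
  where
    "free_vars (FMonomialLe n k r) = {..<n}"
  | "free_vars (FAnd P Q) = free_vars P \<union> free_vars Q"
  | "free_vars (FOr P Q) = free_vars P \<union> free_vars Q"
  | "free_vars (FNot P) = free_vars P"
  | "free_vars (FEx i P) = free_vars P - {i}"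

primrec holds :: "fo_formula \<Rightarrow> (nat \<Rightarrow> 'a::{comm_semiring_0,comm_monoid_mult}) \<Rightarrow> bool"
  where
    "holds (FMonomialLe n k r) s \<longleftrightarrow> (\<Prod>i<n. s i ^ k i) \<preceq> (\<Prod>i<n. s i ^ r i)"
  | "holds (FAnd P Q) s \<longleftrightarrow> holds P s \<and> holds Q s"
  | "holds (FOr P Q) s \<longleftrightarrow> holds P s \<or> holds Q s"
  | "holds (FNot P) s \<longleftrightarrow> \<not> holds P s"
  | "holds (FEx i P) s \<longleftrightarrow> (\<exists>a. holds P (s(i := a)))"

text \<open>
  The free variables need only be among \<open>x\<^sub>0, \<dots>, x\<^sub>n\<^sub>-\<^sub>1\<close>: a conjunction with
  \<open>FMonomialLe n k k\<close> makes all of them free without changing the set defined.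
\<close>

definition definable :: "nat \<Rightarrow> 'a::{comm_semiring_0,comm_monoid_mult} vec set \<Rightarrow> bool"
  where "definable n D \<longleftrightarrow>
    (\<exists>P. free_vars P \<subseteq> {..<n} \<and> D = {x \<in> carrier_vec n. holds P (\<lambda>i. x $ i)})"

definition presburger_property :: "'a::{comm_semiring_0,comm_monoid_mult} itself \<Rightarrow> bool"
  where "presburger_property _ \<longleftrightarrow>
    (\<forall>n. {D :: 'a vec set. definable n D} = {D. rational_subset (entrywise_monoid n) D})"

end

theory Submission
  imports Defs
begin

text \<open>
  In a totally ordered idempotent semiring every coordinate of a linear combination is attained by
  one of its terms, so vectors of a span in dimension \<open>n\<close> are combinations of \<open>n\<close> generators. Hence
  the span of a definable set is definable, and by the Presburger property the rational semimodules
  are exactly the definable subsemimodules. All the constructions preserve definability: sums are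
  least upper bounds for \<open>\<preceq>\<close>, which makes equations between scalar products first-order, and the
  graph of a linear map is a finitely generated semimodule.
\<close>

section \<open>First-order expressible predicates\<close>

text \<open>Rational subsets of a monoid need not be closed under intersection or complement,
  whereas definable sets are; hence every construction is carried out on the definable side. Three
  limits of the formula language shape the proof. It has no addition, so equations involving sums
  must be rephrased through \<open>\<preceq>\<close> alone. It has no constants, so the coefficients
  of a linear map cannot be written into a formula; they enter through finite sets of vectors, which
  are rational by definition and therefore definable by hypothesis. It cannot quantify over the
  length of a combination, so a span becomes expressible only once that length is bounded by the
  dimension. Formulas are handled semantically, as predicates on assignments, so that renaming and
  the choice of bound variables are settled once and for all.\<close>

lemma natural_le_antisym:
  fixes x y :: "'a::ab_semigroup_add"
  assumes "x \<preceq> y" "y \<preceq> x"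
  shows "x = y"
  using assms unfolding natural_le_def by (metis add.commute)

lemma holds_cong:
  assumes "\<And>i. i \<in> free_vars P \<Longrightarrow> s i = t i"
  shows "holds P s \<longleftrightarrow> holds P t"
  using assms
proof (induction P arbitrary: s t)
  case (FMonomialLe n k r)
  then have "s i = t i" if "i < n" for i
    using that by simp
  then have "(\<Prod>i<n. s i ^ k i) = (\<Prod>i<n. t i ^ k i)" "(\<Prod>i<n. s i ^ r i) = (\<Prod>i<n. t i ^ r i)"
    by (simp_all cong: prod.cong_simp)
  then show ?case by simp
next
  case (FAnd P Q)
  have "holds P s = holds P t" by (rule FAnd.IH(1)) (simp add: FAnd.prems)
  moreover have "holds Q s = holds Q t" by (rule FAnd.IH(2)) (simp add: FAnd.prems)
  ultimately show ?case by simp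
next
  case (FOr P Q)
  have "holds P s = holds P t" by (rule FOr.IH(1)) (simp add: FOr.prems)
  moreover have "holds Q s = holds Q t" by (rule FOr.IH(2)) (simp add: FOr.prems)
  ultimately show ?case by simp
next
  case (FNot P)
  have "holds P s = holds P t" by (rule FNot.IH) (simp add: FNot.prems)
  then show ?case by simp
next
  case (FEx i P)
  have "holds P (s(i := a)) = holds P (t(i := a))" for a
    by (rule FEx.IH) (simp add: FEx.prems)
  then show ?case by simp
qed

lemma finite_free_vars: "finite (free_vars P)"
  by (induction P) auto

text \<open>Obtained by iterating \<open>FEx\<close> over \<open>I\<close>. The free variables are
  tracked exactly because \<open>definable_iff_fo\<close> uses this to eliminate variables beyond
  the dimension.\<close>

lemma exists_quantified_formula:
  assumes "finite I"
  shows "\<exists>Q. free_vars Q = free_vars P - I \<and>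
    (\<forall>s :: nat \<Rightarrow> 'a::{comm_semiring_0,comm_monoid_mult}.
      holds Q s \<longleftrightarrow> (\<exists>b. holds P (override_on s b I)))"
  using assms
proof (induction I rule: finite_induct)
  case empty
  show ?case by (rule exI[of _ P]) simp
next
  case (insert i I)
  then obtain Q where Q: "free_vars Q = free_vars P - I"
    "\<And>s :: nat \<Rightarrow> 'a. holds Q s \<longleftrightarrow> (\<exists>b. holds P (override_on s b I))"
    by auto
  have "holds (FEx i Q) s \<longleftrightarrow> (\<exists>b. holds P (override_on s b (insert i I)))" for s :: "nat \<Rightarrow> 'a"
  proof -
    have eq1: "override_on (s(i := a)) b I = override_on s (b(i := a)) (insert i I)" for a b
      using insert.hyps by (auto simp: override_on_def fun_eq_iff)
    have eq2: "override_on s b (insert i I) = override_on (s(i := b i)) b I" for b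
      using insert.hyps by (auto simp: override_on_def fun_eq_iff)
    have "holds (FEx i Q) s \<longleftrightarrow> (\<exists>a b. holds P (override_on (s(i := a)) b I))"
      by (simp add: Q)
    also have "\<dots> \<longleftrightarrow> (\<exists>b. holds P (override_on s b (insert i I)))"
    proof
      assume "\<exists>b. holds P (override_on s b (insert i I))"
      then show "\<exists>a b. holds P (override_on (s(i := a)) b I)"
        unfolding eq2 by blast
    qed (unfold eq1, blast)
    finally show ?thesis .
  qed
  moreover have "free_vars (FEx i Q) = free_vars P - insert i I"
    using Q by auto
  ultimately show ?case by blast
qed

text \<open>A semantic notion without any bound on the variables: its closure lemmas can then be
  chained like introduction rules, and free variables matter again only in
  \<open>definable_iff_fo\<close>.\<close>

definition fo_expressible ::
    "((nat \<Rightarrow> 'a::{comm_semiring_0,comm_monoid_mult}) \<Rightarrow> bool) \<Rightarrow> bool"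
  where "fo_expressible \<phi> \<longleftrightarrow> (\<exists>P. \<forall>s. holds P s \<longleftrightarrow> \<phi> s)"

lemma fo_expressible_holds: "fo_expressible (holds P)"
  unfolding fo_expressible_def by blast

lemma fo_expressibleI: "(\<And>s. holds P s \<longleftrightarrow> \<phi> s) \<Longrightarrow> fo_expressible \<phi>"
  unfolding fo_expressible_def by blast

lemma fo_expressibleE:
  assumes "fo_expressible \<phi>"
  obtains P where "\<phi> = holds P"
proof -
  from assms obtain P where "\<forall>s. holds P s = \<phi> s"
    unfolding fo_expressible_def by (rule exE)
  then have "\<phi> = holds P" by (intro ext) simp
  then show thesis by (rule that)
qed

lemma fo_conj:
  assumes "fo_expressible \<phi>" "fo_expressible \<psi>"
  shows "fo_expressible (\<lambda>s. \<phi> s \<and> \<psi> s)"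
proof -
  obtain P Q where "\<phi> = holds P" "\<psi> = holds Q"
    using assms by (elim fo_expressibleE)
  then show ?thesis by (intro fo_expressibleI[of "FAnd P Q"]) simp
qed

lemma fo_disj:
  assumes "fo_expressible \<phi>" "fo_expressible \<psi>"
  shows "fo_expressible (\<lambda>s. \<phi> s \<or> \<psi> s)"
proof -
  obtain P Q where "\<phi> = holds P" "\<psi> = holds Q"
    using assms by (elim fo_expressibleE)
  then show ?thesis by (intro fo_expressibleI[of "FOr P Q"]) simp
qed

lemma fo_not:
  assumes "fo_expressible \<phi>"
  shows "fo_expressible (\<lambda>s. \<not> \<phi> s)"
proof -
  obtain P where "\<phi> = holds P"
    using assms by (elim fo_expressibleE)
  then show ?thesis by (intro fo_expressibleI[of "FNot P"]) simp
qed

lemma fo_imp: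
  assumes "fo_expressible \<phi>" "fo_expressible \<psi>"
  shows "fo_expressible (\<lambda>s. \<phi> s \<longrightarrow> \<psi> s)"
  unfolding imp_conv_disj by (rule fo_disj[OF fo_not[OF assms(1)] assms(2)])

lemma fo_iff:
  assumes "fo_expressible \<phi>" "fo_expressible \<psi>"
  shows "fo_expressible (\<lambda>s. \<phi> s \<longleftrightarrow> \<psi> s)"
  unfolding iff_conv_conj_imp
  by (rule fo_conj[OF fo_imp[OF assms] fo_imp[OF assms(2,1)]])

lemma fo_ex:
  assumes "fo_expressible \<phi>"
  shows "fo_expressible (\<lambda>s. \<exists>a. \<phi> (s(i := a)))"
proof -
  obtain P where "\<phi> = holds P"
    using assms by (elim fo_expressibleE)
  then show ?thesis by (intro fo_expressibleI[of "FEx i P"]) simp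
qed

lemma fo_ex_finite:
  assumes "fo_expressible \<phi>" "finite I"
  shows "fo_expressible (\<lambda>s. \<exists>b. \<phi> (override_on s b I))"
proof -
  obtain P where P: "\<phi> = holds P"
    using assms(1) by (rule fo_expressibleE)
  obtain Q where "free_vars Q = free_vars P - I \<and>
      (\<forall>s :: nat \<Rightarrow> 'a. holds Q s \<longleftrightarrow> (\<exists>b. holds P (override_on s b I)))"
    using exists_quantified_formula[OF assms(2), of P, where 'a = 'a] by (elim exE)
  then show ?thesis
    unfolding P by (intro fo_expressibleI[of Q]) simp
qed

text \<open>Monomials are written as lists of variables with repetition; the exponent of a variable
  is its \<open>count_list\<close>. This hides both the exponents and the number of variables of the
  atomic formula.\<close>

lemma fo_monomial_le:
  "fo_expressible (\<lambda>s :: nat \<Rightarrow> 'a::{comm_semiring_0,comm_monoid_mult}.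
    prod_list (map s is) \<preceq> prod_list (map s js))"
proof -
  \<comment> \<open>The inserted 0 keeps \<open>Max\<close> meaningful when both lists are
    empty.\<close>
  define N where "N = Suc (Max (insert 0 (set is \<union> set js)))"
  have N: "set is \<subseteq> {..<N}" "set js \<subseteq> {..<N}"
    unfolding N_def by (auto simp: less_Suc_eq_le intro!: Max_ge)
  have prod: "(\<Prod>l<N. s l ^ count_list is l) = prod_list (map s is)" if "set is \<subseteq> {..<N}"
    for s :: "nat \<Rightarrow> 'a" and "is"
    using that
  proof (induction "is")
    case (Cons i "is")
    have "(\<Prod>l<N. s l ^ count_list (i # is) l)
        = (\<Prod>l<N. (if l = i then s l else 1) * s l ^ count_list is l)"
      by (intro prod.cong) auto
    then show ?case
      using Cons by (simp add: prod.distrib)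
  qed simp
  have "holds (FMonomialLe N (count_list is) (count_list js)) s
      \<longleftrightarrow> prod_list (map s is) \<preceq> prod_list (map s js)" for s :: "nat \<Rightarrow> 'a"
    by (simp add: prod N)
  then show ?thesis unfolding fo_expressible_def by blast
qed

lemma fo_le:
  "fo_expressible (\<lambda>s :: nat \<Rightarrow> 'a::{comm_semiring_0,comm_monoid_mult}. s i \<preceq> s j)"
  using fo_monomial_le[of "[i]" "[j]"] by simp

lemma fo_mult_le:
  "fo_expressible (\<lambda>s :: nat \<Rightarrow> 'a::{comm_semiring_0,comm_monoid_mult}. s i * s j \<preceq> s k)"
  using fo_monomial_le[of "[i, j]" "[k]"] by simp

lemma fo_le_mult:
  "fo_expressible (\<lambda>s :: nat \<Rightarrow> 'a::{comm_semiring_0,comm_monoid_mult}. s k \<preceq> s i * s j)"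
  using fo_monomial_le[of "[k]" "[i, j]"] by simp

text \<open>Here \<open>c\<close> is a truth value. The syntax has no truth constants, so they arise
  as an instance of excluded middle and a contradiction.\<close>

lemma fo_const: "fo_expressible (\<lambda>s :: nat \<Rightarrow> 'a::{comm_semiring_0,comm_monoid_mult}. c)"
  using fo_conj[OF fo_le[of 0 0] fo_not[OF fo_le[of 0 0]], where 'a = 'a]
    fo_disj[OF fo_le[of 0 0] fo_not[OF fo_le[of 0 0]], where 'a = 'a]
  by (cases c) simp_all

lemma fo_all_less:
  fixes n :: nat
  assumes "\<And>i. i < n \<Longrightarrow> fo_expressible (\<phi> i)"
  shows "fo_expressible (\<lambda>s. \<forall>i<n. \<phi> i s)"
  using assms
proof (induction n)
  case 0
  then show ?case using fo_const[of True] by simp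
next
  case (Suc n)
  then have "fo_expressible (\<lambda>s. (\<forall>i<n. \<phi> i s) \<and> \<phi> n s)"
    by (intro fo_conj) auto
  moreover have "(\<lambda>s. \<forall>i<Suc n. \<phi> i s) = (\<lambda>s. (\<forall>i<n. \<phi> i s) \<and> \<phi> n s)"
    by (auto simp: fun_eq_iff less_Suc_eq)
  ultimately show ?case by simp
qed

text \<open>Shifting is injective, so bound variables can be shifted along with the free ones and no
  capture occurs.\<close>

lemma fo_shift: "fo_expressible (\<lambda>s. holds P (\<lambda>i. s (i + N)))"
proof (induction P)
  case (FMonomialLe n k r)
  have prod: "(\<Prod>i<n. s (i + N) ^ k i)
      = prod_list (map s (concat (map (\<lambda>i. replicate (k i) (i + N)) [0..<n])))" for s :: "nat \<Rightarrow> 'a" and k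
    by (induction n) (auto simp: mult.commute)
  show ?case
    using fo_monomial_le unfolding holds.simps prod .
next
  case (FEx i P)
  have "(\<lambda>j. s (j + N))(i := a) = (\<lambda>j. (s(i + N := a)) (j + N))" for s :: "nat \<Rightarrow> 'a" and a
    by auto
  then show ?case
    using fo_ex[OF FEx, of "i + N"] by simp
qed (simp_all add: fo_conj fo_disj fo_not)

section \<open>Subsemimodules and linear maps\<close>

lemma subsemimodule_zero:
  assumes "subsemimodule n X"
  shows "0\<^sub>v n \<in> X"
proof -
  obtain x where x: "x \<in> X" "x \<in> carrier_vec n" using assms unfolding subsemimodule_def by blast
  then have "0 \<cdot>\<^sub>v x + 0 \<cdot>\<^sub>v x \<in> X" using assms unfolding subsemimodule_def by blast
  moreover have "0 \<cdot>\<^sub>v x + 0 \<cdot>\<^sub>v x = 0\<^sub>v n" using x by (intro eq_vecI) auto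
  ultimately show ?thesis by simp
qed

lemma subsemimodule_add:
  assumes "subsemimodule n X" "x \<in> X" "y \<in> X"
  shows "x + y \<in> X"
proof -
  have "1 \<cdot>\<^sub>v x + 1 \<cdot>\<^sub>v y \<in> X" using assms unfolding subsemimodule_def by blast
  moreover have "1 \<cdot>\<^sub>v x = x" "1 \<cdot>\<^sub>v y = y" by (intro eq_vecI; simp)+
  ultimately show ?thesis by simp
qed

lemma subsemimodule_smult:
  assumes "subsemimodule n X" "x \<in> X"
  shows "l \<cdot>\<^sub>v x \<in> X"
proof -
  have x: "x \<in> carrier_vec n" using assms unfolding subsemimodule_def by blast
  have "l \<cdot>\<^sub>v x + 0 \<cdot>\<^sub>v x \<in> X" using assms unfolding subsemimodule_def by blast
  moreover have "l \<cdot>\<^sub>v x + 0 \<cdot>\<^sub>v x = l \<cdot>\<^sub>v x" using x by (intro eq_vecI) auto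
  ultimately show ?thesis by simp
qed

lemma subsemimodule_combination:
  "subsemimodule n X \<Longrightarrow> x \<in> X \<Longrightarrow> y \<in> X \<Longrightarrow> l \<cdot>\<^sub>v x + m \<cdot>\<^sub>v y \<in> X"
  unfolding subsemimodule_def by blast

lemma subsemimoduleI:
  assumes "X \<subseteq> carrier_vec n" "0\<^sub>v n \<in> X"
    and "\<And>x y l m. x \<in> X \<Longrightarrow> y \<in> X \<Longrightarrow> l \<cdot>\<^sub>v x + m \<cdot>\<^sub>v y \<in> X"
  shows "subsemimodule n X"
  using assms unfolding subsemimodule_def by blast

lemma span_subset_subsemimodule:
  assumes "subsemimodule n X" "U \<subseteq> X"
  shows "semimodule_span n U \<subseteq> X"
proof -
  have "vec n (\<lambda>i. \<Sum>j<k. (c j \<cdot>\<^sub>v u j) $ i) \<in> X" if "\<forall>j<k. u j \<in> U" for k :: nat and c u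
    using that
  proof (induction k)
    case 0
    then show ?case using subsemimodule_zero[OF assms(1)] by (simp add: zero_vec_def)
  next
    case (Suc k)
    then have "u k \<in> X" using assms by auto
    moreover from this have "u k \<in> carrier_vec n" using assms unfolding subsemimodule_def by auto
    then have "vec n (\<lambda>i. \<Sum>j<Suc k. (c j \<cdot>\<^sub>v u j) $ i)
        = vec n (\<lambda>i. \<Sum>j<k. (c j \<cdot>\<^sub>v u j) $ i) + c k \<cdot>\<^sub>v u k"
      by (intro eq_vecI) auto
    ultimately show ?case
      using Suc subsemimodule_add[OF assms(1)] subsemimodule_smult[OF assms(1)] by simp
  qed
  then show ?thesis unfolding semimodule_span_def by blast
qed

lemma span_eq_subsemimodule:
  assumes "subsemimodule n X"
  shows "semimodule_span n X = X"
proof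
  show "X \<subseteq> semimodule_span n X"
  proof
    fix x assume x: "x \<in> X"
    then have "x \<in> carrier_vec n" using assms unfolding subsemimodule_def by auto
    then have "x = vec n (\<lambda>i. \<Sum>j<1::nat. (1 \<cdot>\<^sub>v x) $ i)" by (intro eq_vecI) auto
    then show "x \<in> semimodule_span n X"
      unfolding semimodule_span_def using x
      by (intro CollectI exI[of _ "1::nat"] exI[of _ "\<lambda>_. 1"] exI[of _ "\<lambda>_. x"]) simp
  qed
qed (simp add: span_subset_subsemimodule assms)

lemma smult_add_append_vec:
  fixes a :: "'a::{comm_semiring_0,comm_monoid_mult} vec"
  assumes "a \<in> carrier_vec n" "a' \<in> carrier_vec n" "b \<in> carrier_vec m" "b' \<in> carrier_vec m"
  shows "l \<cdot>\<^sub>v (a @\<^sub>v b) + k \<cdot>\<^sub>v (a' @\<^sub>v b') = (l \<cdot>\<^sub>v a + k \<cdot>\<^sub>v a') @\<^sub>v (l \<cdot>\<^sub>v b + k \<cdot>\<^sub>v b')"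
  using assms by (intro eq_vecI) auto

text \<open>\<open>unit_vec\<close> is not available, because its type class includes \<open>0 \<noteq> 1\<close>.\<close>

definition basis_vec :: "nat \<Rightarrow> nat \<Rightarrow> 'a::{comm_semiring_0,comm_monoid_mult} vec"
  where "basis_vec n j = vec n (\<lambda>i. if i = j then 1 else 0)"

lemma basis_vec_carrier [simp]: "basis_vec n j \<in> carrier_vec n"
  and dim_basis_vec [simp]: "dim_vec (basis_vec n j) = n"
  and index_basis_vec [simp]: "i < n \<Longrightarrow> basis_vec n j $ i = (if i = j then 1 else 0)"
  by (simp_all add: basis_vec_def)

lemma semimodule_hom_combination:
  assumes "semimodule_hom n p A" "x \<in> carrier_vec n" "y \<in> carrier_vec n"
  shows "A (l \<cdot>\<^sub>v x + m \<cdot>\<^sub>v y) = l \<cdot>\<^sub>v A x + m \<cdot>\<^sub>v A y"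
  using assms unfolding semimodule_hom_def by simp

text \<open>The matrix form of \<open>A\<close>, with columns
  \<open>A (basis_vec n j)\<close>.\<close>

lemma semimodule_hom_index:
  assumes A: "semimodule_hom n p A" and x: "x \<in> carrier_vec n" and r: "r < p"
  shows "A x $ r = (\<Sum>j<n. x $ j * A (basis_vec n j) $ r)"
proof -
  \<comment> \<open>The truncation of \<open>x\<close> to its first \<open>m\<close> coordinates;
    raising \<open>m\<close> by one adds a single multiple of a basis vector, which is what the
    induction needs.\<close>
  let ?x = "\<lambda>m. vec n (\<lambda>i. if i < m then x $ i else 0)"
  have carrier: "A y \<in> carrier_vec p" if "y \<in> carrier_vec n" for y
    using A that unfolding semimodule_hom_def by auto
  have "A (?x m) $ r = (\<Sum>j<m. x $ j * A (basis_vec n j) $ r)" if "m \<le> n" for m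
    using that
  proof (induction m)
    case 0
    have "?x 0 = 0\<^sub>v n" by auto
    then show ?case using A r unfolding semimodule_hom_def by simp
  next
    case (Suc m)
    have "?x (Suc m) = ?x m + x $ m \<cdot>\<^sub>v basis_vec n m"
      using Suc.prems by (intro eq_vecI) (auto simp: less_Suc_eq)
    then have "A (?x (Suc m)) = A (?x m) + x $ m \<cdot>\<^sub>v A (basis_vec n m)"
      using A unfolding semimodule_hom_def by simp
    then show ?case
      using Suc r carrier[of "basis_vec n m"] by simp
  qed
  moreover have "?x n = x" using x by (intro eq_vecI) auto
  ultimately show ?thesis by fastforce
qed

lemma subsemimodule_graph:
  assumes A: "semimodule_hom n p A"
  shows "subsemimodule (n + p) {x @\<^sub>v A x | x. x \<in> carrier_vec n}"
proof -
  have carrier: "A x \<in> carrier_vec p" if "x \<in> carrier_vec n" for x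
    using A that unfolding semimodule_hom_def by auto
  have "\<exists>z. l \<cdot>\<^sub>v (x @\<^sub>v A x) + m \<cdot>\<^sub>v (y @\<^sub>v A y) = z @\<^sub>v A z \<and> z \<in> carrier_vec n"
    if "x \<in> carrier_vec n" "y \<in> carrier_vec n" for x y l m
    using that carrier
    by (intro exI[of _ "l \<cdot>\<^sub>v x + m \<cdot>\<^sub>v y"])
      (simp add: smult_add_append_vec[of _ n _ _ p] semimodule_hom_combination[OF A])
  then show ?thesis
    unfolding subsemimodule_def using carrier zero_carrier_vec by blast
qed

lemma append_mem_graph_iff:
  assumes "x \<in> carrier_vec n"
  shows "x @\<^sub>v v \<in> {x @\<^sub>v A x | x. x \<in> carrier_vec n} \<longleftrightarrow> v = A x"
proof
  assume "x @\<^sub>v v \<in> {x @\<^sub>v A x | x. x \<in> carrier_vec n}"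
  then obtain y where "x @\<^sub>v v = y @\<^sub>v A y" "y \<in> carrier_vec n" by blast
  then show "v = A x" using append_vec_eq[OF assms] by simp
qed (use assms in blast)

text \<open>The coordinates of \<open>x\<close> serve as coefficients: the first block of the
  combination is \<open>x\<close>, the second is \<open>A x\<close> by
  \<open>semimodule_hom_index\<close>. The generating set is finite, which makes the graph definable
  although its entries are arbitrary scalars.\<close>

lemma span_graph:
  assumes A: "semimodule_hom n p A"
  shows "{x @\<^sub>v A x | x. x \<in> carrier_vec n}
    = semimodule_span (n + p) ((\<lambda>j. basis_vec n j @\<^sub>v A (basis_vec n j)) ` {..<n})"
    (is "?graph = semimodule_span _ ?U")
proof
  have carrier: "A x \<in> carrier_vec p" if "x \<in> carrier_vec n" for x
    using A that unfolding semimodule_hom_def by auto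
  show "?graph \<subseteq> semimodule_span (n + p) ?U"
  proof
    fix z assume "z \<in> ?graph"
    then obtain x where x: "x \<in> carrier_vec n" and z: "z = x @\<^sub>v A x" by blast
    let ?u = "\<lambda>j. basis_vec n j @\<^sub>v A (basis_vec n j)"
    have "z = vec (n + p) (\<lambda>i. \<Sum>j<n. (x $ j \<cdot>\<^sub>v ?u j) $ i)"
    proof (rule eq_vecI)
      fix i assume "i < dim_vec (vec (n + p) (\<lambda>i. \<Sum>j<n. (x $ j \<cdot>\<^sub>v ?u j) $ i))"
      then have i: "i < n + p" by simp
      have dim: "dim_vec (A y) = p" if "y \<in> carrier_vec n" for y using carrier[OF that] by auto
      show "z $ i = vec (n + p) (\<lambda>i. \<Sum>j<n. (x $ j \<cdot>\<^sub>v ?u j) $ i) $ i"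
      proof (cases "i < n")
        case True
        have "(\<Sum>j<n. x $ j * basis_vec n j $ i) = (\<Sum>j<n. if j = i then x $ j else 0)"
          using True by (intro sum.cong) auto
        then show ?thesis using True x i z dim by simp
      next
        case False
        then have "z $ i = A x $ (i - n)" using x i z dim by simp
        also have "\<dots> = (\<Sum>j<n. x $ j * A (basis_vec n j) $ (i - n))"
          using False i by (intro semimodule_hom_index[OF A x]) simp
        finally show ?thesis using False i dim by simp
      qed
    qed (use z x carrier[OF x] in auto)
    then show "z \<in> semimodule_span (n + p) ?U"
      unfolding semimodule_span_def
      by (intro CollectI exI[of _ n] exI[of _ "\<lambda>j. x $ j"] exI[of _ ?u]) simp
  qed
  show "semimodule_span (n + p) ?U \<subseteq> ?graph"
    by (rule span_subset_subsemimodule[OF subsemimodule_graph[OF A]]) auto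
qed

section \<open>Idempotent semirings\<close>

context
  assumes idempotent: "\<And>x :: 'a::{comm_semiring_0,comm_monoid_mult}. x + x = x"
begin

lemma natural_le_refl: "(x :: 'a) \<preceq> x"
  by (simp add: natural_le_def idempotent)

lemma eq_iff_natural_le: "(x :: 'a) = y \<longleftrightarrow> x \<preceq> y \<and> y \<preceq> x"
  using natural_le_refl natural_le_antisym by blast

lemma add_natural_le_iff: "(x :: 'a) + y \<preceq> z \<longleftrightarrow> x \<preceq> z \<and> y \<preceq> z"
  unfolding natural_le_def by (metis add.assoc add.commute idempotent)

lemma zero_natural_le: "(0 :: 'a) \<preceq> x"
  by (simp add: natural_le_def)

lemma sum_natural_le_iff:
  fixes h :: "'b \<Rightarrow> 'a"
  assumes "finite I"
  shows "(\<Sum>i\<in>I. h i) \<preceq> t \<longleftrightarrow> (\<forall>i\<in>I. h i \<preceq> t)"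
  using assms by induction (auto simp: add_natural_le_iff zero_natural_le)

text \<open>Taking \<open>t = x\<close> and \<open>t = y\<close> gives both inequalities. This
  allows two sums to be equated without either being a term of the language.\<close>

lemma eq_iff_same_upper_bounds: "(x :: 'a) = y \<longleftrightarrow> (\<forall>t. x \<preceq> t \<longleftrightarrow> y \<preceq> t)"
  using natural_le_refl natural_le_antisym by metis

text \<open>The map \<open>f\<close> may identify variables, so a mere renaming of the formula could
  capture. Equality of scalars is expressed by two inequalities, which is where idempotency
  enters.\<close>

lemma fo_subst:
  fixes \<phi> :: "(nat \<Rightarrow> 'a) \<Rightarrow> bool"
  assumes "fo_expressible \<phi>"
  shows "fo_expressible (\<lambda>s. \<phi> (\<lambda>i. s (f i)))"
proof -
  obtain P where P: "\<phi> = holds P"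
    using assms by (rule fo_expressibleE)
  obtain n where n: "free_vars P \<subseteq> {..<n}"
    using finite_free_vars unfolding finite_nat_set_iff_bounded by blast
  obtain N where N: "f ` {..<n} \<subseteq> {..<N}"
    using finite_imageI[OF finite_lessThan[of n], of f] unfolding finite_nat_set_iff_bounded by blast
  \<comment> \<open>The variables are first moved above the range of \<open>f\<close>, which avoids capture when they are
    then identified with the variables \<open>f i\<close> one at a time.\<close>
  have "fo_expressible (\<lambda>s :: nat \<Rightarrow> 'a. holds P (\<lambda>i. if i < m then s (f i) else s (i + N)))" if "m \<le> n" for m
    using that
  proof (induction m)
    case 0
    then show ?case using fo_shift by simp
  next
    case (Suc m)
    \<comment> \<open>Variable \<open>m + N\<close> is forced to carry the value of variable
      \<open>f m\<close> and is then quantified away.\<close>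
    let ?\<psi> = "\<lambda>s :: nat \<Rightarrow> 'a. (s (m + N) \<preceq> s (f m) \<and> s (f m) \<preceq> s (m + N)) \<and>
      holds P (\<lambda>i. if i < m then s (f i) else s (i + N))"
    have "fo_expressible (\<lambda>s. \<exists>a. ?\<psi> (s(m + N := a)))"
      using Suc by (intro fo_ex fo_conj fo_le) auto
    moreover have "(\<exists>a. ?\<psi> (s(m + N := a)))
        \<longleftrightarrow> holds P (\<lambda>i. if i < Suc m then s (f i) else s (i + N))" for s
    proof -
      \<comment> \<open>Updating position \<open>m + N\<close> therefore leaves every value
        \<open>s (f i)\<close> intact.\<close>
      have f: "f i < N" if "i \<le> m" for i
        using N Suc.prems that by (auto simp: image_subset_iff)
      have upd: "(\<lambda>i. if i < m then (s(m + N := s (f m))) (f i) else (s(m + N := s (f m))) (i + N))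
          = (\<lambda>i. if i < Suc m then s (f i) else s (i + N))"
      proof
        fix i
        consider "i < m" | "i = m" | "i > m" by linarith
        then show "(if i < m then (s(m + N := s (f m))) (f i) else (s(m + N := s (f m))) (i + N))
            = (if i < Suc m then s (f i) else s (i + N))"
          by cases (use f[of i] in auto)
      qed
      have \<psi>: "?\<psi> (s(m + N := a)) \<longleftrightarrow> (a \<preceq> s (f m) \<and> s (f m) \<preceq> a) \<and>
          holds P (\<lambda>i. if i < m then (s(m + N := a)) (f i) else (s(m + N := a)) (i + N))" for a
        using f[of m] by simp
      have "?\<psi> (s(m + N := a)) \<longleftrightarrow> a = s (f m) \<and> holds P (\<lambda>i. if i < Suc m then s (f i) else s (i + N))" for a
        unfolding upd[symmetric] \<psi> using natural_le_antisym[of a "s (f m)"] natural_le_refl by auto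
      then show ?thesis by simp
    qed
    ultimately show ?case by simp
  qed
  from this[of n] have "fo_expressible (\<lambda>s :: nat \<Rightarrow> 'a. holds P (\<lambda>i. if i < n then s (f i) else s (i + N)))"
    by simp
  \<comment> \<open>Indices from \<open>n\<close> on still read \<open>s (i + N)\<close>, but no
    free variable of \<open>P\<close> lies there.\<close>
  moreover have "holds P (\<lambda>i. if i < n then s (f i) else s (i + N)) \<longleftrightarrow> \<phi> (\<lambda>i. s (f i))" for s
    unfolding P by (rule holds_cong) (use n in auto)
  ultimately show ?thesis by simp
qed

text \<open>As with de Bruijn indices, slot 0 holds the bound scalar and the surrounding assignment
  moves up by one. The substitution \<open>i - 1\<close> undoes the move; its value at 0 is never
  read, since the quantifier overwrites slot 0.\<close>

lemma fo_ex_scalar: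
  fixes \<Phi> :: "'a \<Rightarrow> (nat \<Rightarrow> 'a) \<Rightarrow> bool"
  assumes "fo_expressible (\<lambda>s. \<Phi> (s 0) (\<lambda>i. s (Suc i)))"
  shows "fo_expressible (\<lambda>s. \<exists>a. \<Phi> a s)"
  using fo_subst[OF fo_ex[OF assms, of 0], of "\<lambda>i. i - 1"] by simp

lemma fo_all_scalar:
  fixes \<Phi> :: "'a \<Rightarrow> (nat \<Rightarrow> 'a) \<Rightarrow> bool"
  assumes "fo_expressible (\<lambda>s. \<Phi> (s 0) (\<lambda>i. s (Suc i)))"
  shows "fo_expressible (\<lambda>s. \<forall>a. \<Phi> a s)"
  using fo_not[OF fo_ex_scalar[OF fo_not[OF assms]]] by simp

text \<open>
  The quantified vector is stored in the even variables and the surrounding assignment in the odd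
  ones, so that nested quantifiers never need fresh names.
\<close>

lemma fo_ex_vec:
  fixes \<Phi> :: "'a vec \<Rightarrow> (nat \<Rightarrow> 'a) \<Rightarrow> bool"
  assumes "fo_expressible (\<lambda>s. \<Phi> (vec n (\<lambda>i. s (2 * i))) (\<lambda>i. s (2 * i + 1)))"
  shows "fo_expressible (\<lambda>s. \<exists>v\<in>carrier_vec n. \<Phi> v s)"
proof -
  let ?I = "(*) 2 ` {..<n}"
  let ?\<psi> = "\<lambda>s. \<Phi> (vec n (\<lambda>i. s (2 * i))) (\<lambda>i. s (2 * i + 1))"
  \<comment> \<open>Reading \<open>s\<close> through \<open>i div 2\<close> puts \<open>s i\<close>
    at position \<open>2 * i + 1\<close>, while the even positions below \<open>2 * n\<close> are
    overwritten by \<open>b\<close>.\<close>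
  have "fo_expressible (\<lambda>s. \<exists>b. ?\<psi> (override_on (\<lambda>i. s (i div 2)) b ?I))"
    by (rule fo_subst[OF fo_ex_finite[OF assms]]) simp
  moreover have "(\<exists>b. ?\<psi> (override_on (\<lambda>i. s (i div 2)) b ?I)) \<longleftrightarrow> (\<exists>v\<in>carrier_vec n. \<Phi> v s)" for s
  proof -
    have "vec n (\<lambda>i. override_on (\<lambda>i. s (i div 2)) b ?I (2 * i)) = vec n (\<lambda>i. b (2 * i))" for b
      by (auto simp: override_on_def)
    moreover have "override_on (\<lambda>i. s (i div 2)) b ?I (2 * i + 1) = s i" for b i
      by (auto simp: override_on_def) presburger
    moreover have "(\<exists>b. \<Phi> (vec n (\<lambda>i. b (2 * i))) s) \<longleftrightarrow> (\<exists>v\<in>carrier_vec n. \<Phi> v s)"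
    proof
      assume "\<exists>v\<in>carrier_vec n. \<Phi> v s"
      then obtain v where "v \<in> carrier_vec n" "\<Phi> v s" by blast
      moreover from this have "vec n (\<lambda>i. v $ (2 * i div 2)) = v" by auto
      ultimately show "\<exists>b. \<Phi> (vec n (\<lambda>i. b (2 * i))) s"
        by (intro exI[of _ "\<lambda>i. v $ (i div 2)"]) simp
    qed auto
    ultimately show ?thesis by simp
  qed
  ultimately show ?thesis by simp
qed

section \<open>Definable sets\<close>

text \<open>Membership of \<open>vec n s\<close> depends only on the first \<open>n\<close> values
  of \<open>s\<close>. Surplus free variables of a formula expressing it can thus be existentially
  quantified without changing its truth.\<close>

lemma definable_iff_fo:
  fixes D :: "'a vec set"
  shows "definable n D \<longleftrightarrow> D \<subseteq> carrier_vec n \<and> fo_expressible (\<lambda>s. vec n s \<in> D)"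
proof
  assume "definable n D"
  then obtain P where P: "free_vars P \<subseteq> {..<n}" "D = {x \<in> carrier_vec n. holds P (\<lambda>i. x $ i)}"
    unfolding definable_def by blast
  have "vec n s \<in> D \<longleftrightarrow> holds P s" for s
    unfolding P(2) by (simp, rule holds_cong) (use P(1) in auto)
  then show "D \<subseteq> carrier_vec n \<and> fo_expressible (\<lambda>s. vec n s \<in> D)"
    using P(2) fo_expressible_holds by auto
next
  assume "D \<subseteq> carrier_vec n \<and> fo_expressible (\<lambda>s. vec n s \<in> D)"
  then have D: "D \<subseteq> carrier_vec n" and "fo_expressible (\<lambda>s. vec n s \<in> D)"
    by auto
  from this(2) obtain P where "(\<lambda>s. vec n s \<in> D) = holds P"
    by (rule fo_expressibleE)
  then have P: "holds P s \<longleftrightarrow> vec n s \<in> D" for s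
    by (simp add: fun_eq_iff)
  let ?I = "free_vars P - {..<n}"
  obtain Q where Q: "free_vars Q = free_vars P - ?I"
    "\<And>s :: nat \<Rightarrow> 'a. holds Q s \<longleftrightarrow> (\<exists>b. holds P (override_on s b ?I))"
    using exists_quantified_formula[of ?I P] finite_free_vars by auto
  have "holds Q (\<lambda>i. x $ i) \<longleftrightarrow> x \<in> D" if "x \<in> carrier_vec n" for x
  proof -
    have "vec n (override_on (\<lambda>i. x $ i) b ?I) = x" for b
      using that by (auto simp: override_on_def)
    then show ?thesis unfolding Q(2) P by simp
  qed
  then have "D = {x \<in> carrier_vec n. holds Q (\<lambda>i. x $ i)}"
    using D by auto
  moreover have "free_vars Q \<subseteq> {..<n}" using Q(1) by auto
  ultimately show "definable n D" unfolding definable_def by blast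
qed

lemma definable_carrier: "definable n (D :: 'a vec set) \<Longrightarrow> D \<subseteq> carrier_vec n"
  by (simp add: definable_iff_fo)

text \<open>The arbitrary \<open>f\<close> lets a vector be read from any slots, in particular from
  the interleaved ones created by vector quantifiers.\<close>

lemma fo_mem:
  fixes D :: "'a vec set"
  shows "definable n D \<Longrightarrow> fo_expressible (\<lambda>s. vec n (\<lambda>i. s (f i)) \<in> D)"
  unfolding definable_iff_fo using fo_subst[of "\<lambda>s. vec n s \<in> D" f] by simp

lemma fo_append_mem:
  fixes D :: "'a vec set"
  assumes "definable (n + m) D"
  shows "fo_expressible (\<lambda>s. vec n (\<lambda>i. s (f i)) @\<^sub>v vec m (\<lambda>i. s (g i)) \<in> D)"
proof -
  have "vec n (\<lambda>i. s (f i)) @\<^sub>v vec m (\<lambda>i. s (g i))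
      = vec (n + m) (\<lambda>i. s (if i < n then f i else g (i - n)))" for s :: "nat \<Rightarrow> 'a"
    by (intro eq_vecI) auto
  then show ?thesis using fo_mem[OF assms] by simp
qed

lemma fo_bex:
  fixes \<Phi> :: "'a vec \<Rightarrow> (nat \<Rightarrow> 'a) \<Rightarrow> bool"
  assumes "definable n D" "fo_expressible (\<lambda>s. \<Phi> (vec n (\<lambda>i. s (2 * i))) (\<lambda>i. s (2 * i + 1)))"
  shows "fo_expressible (\<lambda>s. \<exists>v\<in>D. \<Phi> v s)"
proof -
  have "fo_expressible (\<lambda>s. \<exists>v\<in>carrier_vec n. v \<in> D \<and> \<Phi> v s)"
    by (intro fo_ex_vec fo_conj fo_mem assms)
  moreover have "(\<exists>v\<in>carrier_vec n. v \<in> D \<and> \<Phi> v s) \<longleftrightarrow> (\<exists>v\<in>D. \<Phi> v s)" for s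
    using definable_carrier[OF assms(1)] by auto
  ultimately show ?thesis by simp
qed

lemma fo_ball:
  fixes \<Phi> :: "'a vec \<Rightarrow> (nat \<Rightarrow> 'a) \<Rightarrow> bool"
  assumes "definable n D" "fo_expressible (\<lambda>s. \<Phi> (vec n (\<lambda>i. s (2 * i))) (\<lambda>i. s (2 * i + 1)))"
  shows "fo_expressible (\<lambda>s. \<forall>v\<in>D. \<Phi> v s)"
  using fo_not[OF fo_bex[OF assms(1) fo_not[OF assms(2)]]] by simp

lemma definable_carrier_vec: "definable n (carrier_vec n :: 'a vec set)"
  by (simp add: definable_iff_fo fo_const)

lemma definable_Int:
  fixes D E :: "'a vec set"
  shows "definable n D \<Longrightarrow> definable n E \<Longrightarrow> definable n (D \<inter> E)"
  unfolding definable_iff_fo by (auto intro: fo_conj)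

text \<open>The bound \<open>t\<close> becomes a universally quantified scalar, and bounding a
  finite sum by \<open>t\<close> amounts to finitely many atomic formulas, one per product.\<close>

lemma fo_scalar_prod_eq:
  "fo_expressible (\<lambda>s :: nat \<Rightarrow> 'a. vec n (\<lambda>i. s (f i)) \<bullet> vec n (\<lambda>i. s (g i))
    = vec m (\<lambda>i. s (h i)) \<bullet> vec m (\<lambda>i. s (k i)))"
proof -
  have "(vec n (\<lambda>i. s (f i)) \<bullet> vec n (\<lambda>i. s (g i)) = vec m (\<lambda>i. s (h i)) \<bullet> vec m (\<lambda>i. s (k i)))
    \<longleftrightarrow> (\<forall>t. (\<forall>i<n. s (f i) * s (g i) \<preceq> t) \<longleftrightarrow> (\<forall>i<m. s (h i) * s (k i) \<preceq> t))"
    for s :: "nat \<Rightarrow> 'a"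
    by (subst eq_iff_same_upper_bounds) (simp add: scalar_prod_def sum_natural_le_iff atLeast0LessThan Ball_def)
  moreover have "fo_expressible (\<lambda>s :: nat \<Rightarrow> 'a.
      \<forall>t. (\<forall>i<n. s (f i) * s (g i) \<preceq> t) \<longleftrightarrow> (\<forall>i<m. s (h i) * s (k i) \<preceq> t))"
    by (rule fo_all_scalar) (intro fo_iff fo_all_less fo_mult_le)
  ultimately show ?thesis by simp
qed

section \<open>Totally ordered semirings\<close>

context
  assumes total_order: "\<And>x y :: 'a. x \<preceq> y \<or> y \<preceq> x"
begin

text \<open>Under a total order each binary sum equals one of its two arguments. The condition
  \<open>k > 0\<close> excludes the empty sum, which has no term to attain it.\<close>

lemma sum_attained:
  fixes h :: "nat \<Rightarrow> 'a"
  assumes "k > 0"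
  shows "\<exists>j<k. (\<Sum>j<k. h j) = h j"
  using assms
proof (induction k)
  case (Suc k)
  show ?case
  proof (cases "k = 0")
    case False
    then obtain j where j: "j < k" "(\<Sum>j<k. h j) = h j" using Suc by auto
    have "h j + h k = h k \<or> h j + h k = h j"
      using total_order[of "h j" "h k"] by (auto simp: natural_le_def add.commute)
    then show ?thesis
      using j by (metis less_Suc_eq sum.lessThan_Suc)
  qed auto
qed simp

text \<open>Addition is the maximum: \<open>z\<close> is an upper bound that does not exceed both
  arguments strictly.\<close>

lemma eq_add_iff:
  "(z :: 'a) = x + y \<longleftrightarrow> (x \<preceq> z \<and> y \<preceq> z) \<and> (z \<preceq> x \<or> z \<preceq> y)"
  using total_order[of x y] natural_le_antisym[of z "x + y"] add_natural_le_iff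
    natural_le_refl
  by (metis add.commute natural_le_def)

lemma fo_eq_add: "fo_expressible (\<lambda>s :: nat \<Rightarrow> 'a. s k = s i + s j)"
  unfolding eq_add_iff by (intro fo_conj fo_disj fo_le)

lemma definable_sums:
  fixes T U :: "'a vec set"
  assumes "definable n T" "definable n U"
  shows "definable n {x + y | x y. x \<in> T \<and> y \<in> U}"
proof -
  note carrier = definable_carrier[OF assms(1)] definable_carrier[OF assms(2)]
  have "vec n s \<in> {x + y | x y. x \<in> T \<and> y \<in> U} \<longleftrightarrow>
      (\<exists>x\<in>T. \<exists>y\<in>U. \<forall>i<n. s i = x $ i + y $ i)" for s
  proof -
    have "vec n s = x + y \<longleftrightarrow> (\<forall>i<n. s i = x $ i + y $ i)" if "x \<in> T" "y \<in> U" for x y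
      using that carrier by (auto simp: vec_eq_iff)
    then show ?thesis by blast
  qed
  moreover have "fo_expressible (\<lambda>s. \<exists>x\<in>T. \<exists>y\<in>U. \<forall>i<n. s i = x $ i + y $ i)"
    by (rule fo_bex[OF assms(1)], rule fo_bex[OF assms(2)], rule fo_all_less) (simp add: fo_eq_add)
  moreover have "{x + y | x y. x \<in> T \<and> y \<in> U} \<subseteq> carrier_vec n"
    using carrier by (blast intro: add_carrier_vec)
  ultimately show ?thesis
    unfolding definable_iff_fo by simp
qed

lemma definable_multiples:
  fixes U :: "'a vec set"
  assumes "definable n U"
  shows "definable n {l \<cdot>\<^sub>v u | l u. u \<in> U}"
proof -
  note carrier = definable_carrier[OF assms]
  have "vec n s \<in> {l \<cdot>\<^sub>v u | l u. u \<in> U} \<longleftrightarrow>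
      (\<exists>u\<in>U. \<exists>l. \<forall>i<n. s i \<preceq> l * u $ i \<and> l * u $ i \<preceq> s i)" for s
  proof -
    have "vec n s = l \<cdot>\<^sub>v u \<longleftrightarrow> (\<forall>i<n. s i \<preceq> l * u $ i \<and> l * u $ i \<preceq> s i)" if "u \<in> U" for u l
      using carrier_vecD[of u n] that carrier by (auto simp: vec_eq_iff eq_iff_natural_le)
    then show ?thesis by blast
  qed
  moreover have "fo_expressible (\<lambda>s. \<exists>u\<in>U. \<exists>l. \<forall>i<n. s i \<preceq> l * u $ i \<and> l * u $ i \<preceq> s i)"
    by (rule fo_bex[OF assms], rule fo_ex_scalar, rule fo_all_less)
      (simp add: fo_conj fo_le_mult fo_mult_le)
  ultimately show ?thesis
    unfolding definable_iff_fo using carrier by auto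
qed

lemma span_eq_combinations_of_dim:
  fixes U :: "'a vec set"
  assumes "U \<subseteq> carrier_vec n" "U \<noteq> {}"
  shows "semimodule_span n U
    = {vec n (\<lambda>i. \<Sum>j<n. (c j \<cdot>\<^sub>v u j) $ i) | c u. \<forall>j<n. u j \<in> U}"
proof
  show "semimodule_span n U \<subseteq> {vec n (\<lambda>i. \<Sum>j<n. (c j \<cdot>\<^sub>v u j) $ i) | c u. \<forall>j<n. u j \<in> U}"
  proof
    fix x assume "x \<in> semimodule_span n U"
    then obtain k :: nat and c u where
      x: "x = vec n (\<lambda>i. \<Sum>j<k. (c j \<cdot>\<^sub>v u j) $ i)" and u: "\<forall>j<k. u j \<in> U"
      unfolding semimodule_span_def by blast
    show "x \<in> {vec n (\<lambda>i. \<Sum>j<n. (c j \<cdot>\<^sub>v u j) $ i) | c u. \<forall>j<n. u j \<in> U}"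
    proof (cases "k = 0")
      \<comment> \<open>The empty combination is padded with zero multiples of some generator, which
        requires \<open>U\<close> to be nonempty.\<close>
      case True
      obtain g where g: "g \<in> U" using assms by blast
      then have "g \<in> carrier_vec n" using assms by blast
      then have "x = vec n (\<lambda>i. \<Sum>j<n. (0 \<cdot>\<^sub>v g) $ i)"
        unfolding x using True by (intro eq_vecI) auto
      then show ?thesis using g
        by (intro CollectI exI[of _ "\<lambda>_. 0"] exI[of _ "\<lambda>_. g"]) simp
    next
      case False
      let ?h = "\<lambda>j i. (c j \<cdot>\<^sub>v u j) $ i"
      have "\<exists>j<k. (\<Sum>j<k. ?h j i) = ?h j i" for i
        using False by (intro sum_attained) simp
      \<comment> \<open>\<open>J i\<close> is the index of a term attaining coordinate
        \<open>i\<close>; repetitions among these indices are harmless.\<close>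
      then obtain J where J: "\<And>i. J i < k" "\<And>i. (\<Sum>j<k. ?h j i) = ?h (J i) i" by metis
      have le: "?h j i \<preceq> (\<Sum>j<k. ?h j i)" if "j < k" for i j
        using that sum_natural_le_iff[of "{..<k}" "\<lambda>j. ?h j i" "\<Sum>j<k. ?h j i"]
          natural_le_refl by auto
      have le': "?h (J j) i \<preceq> (\<Sum>j<n. ?h (J j) i)" if "j < n" for i j
        using that sum_natural_le_iff[of "{..<n}" "\<lambda>j. ?h (J j) i" "\<Sum>j<n. ?h (J j) i"]
          natural_le_refl by auto
      \<comment> \<open>The term attaining coordinate \<open>i\<close> is the one chosen for
        \<open>j = i\<close>, which gives one inequality; every chosen term is among the original
        ones, which gives the other.\<close>
      have "(\<Sum>j<k. ?h j i) = (\<Sum>j<n. ?h (J j) i)" if "i < n" for i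
        using le'[OF that, of i] le J
        by (intro natural_le_antisym) (auto simp: sum_natural_le_iff)
      then have "x = vec n (\<lambda>i. \<Sum>j<n. ?h (J j) i)"
        unfolding x by (intro eq_vecI) auto
      then show ?thesis using u J(1)
        by (intro CollectI exI[of _ "\<lambda>j. c (J j)"] exI[of _ "\<lambda>j. u (J j)"]) simp
    qed
  qed
qed (auto simp: semimodule_span_def)

section \<open>Rational semimodules as definable subsemimodules\<close>

context
  assumes presburger: "presburger_property TYPE('a)"
begin

lemma definable_iff_rational_subset:
  "definable n (D :: 'a vec set) \<longleftrightarrow> rational_subset (entrywise_monoid n) D"
  using presburger unfolding presburger_property_def by blast

text \<open>The substitute for constants: no formula is exhibited, its existence comes from the
  Presburger property.\<close>

lemma definable_finite:
  "finite D \<Longrightarrow> D \<subseteq> carrier_vec n \<Longrightarrow> definable n (D :: 'a vec set)"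
  unfolding definable_iff_rational_subset
  by (rule rational_subset.finite) (auto simp: entrywise_monoid_def)

lemma definable_span:
  fixes U :: "'a vec set"
  assumes U: "definable n U"
  shows "definable n (semimodule_span n U)"
proof (cases "U = {}")
  case True
  then have "semimodule_span n U \<subseteq> {0\<^sub>v n}"
    by (intro span_subset_subsemimodule) (auto simp: subsemimodule_def)
  then show ?thesis
    by (intro definable_finite) (auto intro: finite_subset)
next
  case False
  note carrier = definable_carrier[OF U]
  \<comment> \<open>Combinations of exactly \<open>m\<close> generators. Each extra generator adds
    one sum with a multiple, and \<open>T n\<close> is already the whole span.\<close>
  define T where "T m = {vec n (\<lambda>i. \<Sum>j<m. (c j \<cdot>\<^sub>v u j) $ i) | c u. \<forall>j<m. u j \<in> U}" for m :: nat
  have "definable n (T m)" for m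
  proof (induction m)
    case 0
    have "T 0 = {0\<^sub>v n}" by (auto simp: T_def zero_vec_def)
    then show ?case by (simp add: definable_finite)
  next
    case (Suc m)
    have "T (Suc m) = {x + y | x y. x \<in> T m \<and> y \<in> {l \<cdot>\<^sub>v u | l u. u \<in> U}}" (is "_ = ?R")
    proof
      show "T (Suc m) \<subseteq> ?R"
      proof
        fix x assume "x \<in> T (Suc m)"
        then obtain c u where x: "x = vec n (\<lambda>i. \<Sum>j<Suc m. (c j \<cdot>\<^sub>v u j) $ i)"
          and u: "\<forall>j<Suc m. u j \<in> U" unfolding T_def by blast
        then have "u m \<in> carrier_vec n" using carrier by auto
        then have "x = vec n (\<lambda>i. \<Sum>j<m. (c j \<cdot>\<^sub>v u j) $ i) + c m \<cdot>\<^sub>v u m"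
          unfolding x by (intro eq_vecI) auto
        then show "x \<in> ?R" using u unfolding T_def by fastforce
      qed
      show "?R \<subseteq> T (Suc m)"
      proof
        fix x assume "x \<in> ?R"
        then obtain c u l v where x: "x = vec n (\<lambda>i. \<Sum>j<m. (c j \<cdot>\<^sub>v u j) $ i) + l \<cdot>\<^sub>v v"
          and u: "\<forall>j<m. u j \<in> U" and v: "v \<in> U" unfolding T_def by blast
        have "v \<in> carrier_vec n" using v carrier by auto
        then have "x = vec n (\<lambda>i. \<Sum>j<Suc m. ((c(m := l)) j \<cdot>\<^sub>v (u(m := v)) j) $ i)"
          unfolding x by (intro eq_vecI) auto
        moreover have "\<forall>j<Suc m. (u(m := v)) j \<in> U" using u v by auto
        ultimately show "x \<in> T (Suc m)" unfolding T_def by blast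
      qed
    qed
    then show ?case
      using definable_sums[OF Suc definable_multiples[OF U]] by simp
  qed
  then show ?thesis
    unfolding span_eq_combinations_of_dim[OF carrier False] T_def .
qed

text \<open>For the converse, \<open>X\<close> serves as its own generating set. Each closure
  property thus splits into an algebraic part and a logical part.\<close>

lemma rational_semimodule_iff_definable:
  "rational_semimodule n (X :: 'a vec set) \<longleftrightarrow> subsemimodule n X \<and> definable n X"
  unfolding rational_semimodule_def
  using definable_span span_eq_subsemimodule definable_iff_rational_subset by metis

section \<open>Closure properties of rational semimodules\<close>

lemma rational_Int:
  fixes X Y :: "'a vec set"
  assumes "rational_semimodule n X" "rational_semimodule n Y"
  shows "rational_semimodule n (X \<inter> Y)"
proof -
  have X: "subsemimodule n X" "definable n X" and Y: "subsemimodule n Y" "definable n Y"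
    using assms by (simp_all add: rational_semimodule_iff_definable)
  have "subsemimodule n (X \<inter> Y)"
    using definable_carrier[OF X(2)] subsemimodule_zero[OF X(1)] subsemimodule_zero[OF Y(1)]
      subsemimodule_combination[OF X(1)] subsemimodule_combination[OF Y(1)]
    by (intro subsemimoduleI) auto
  then show ?thesis
    using X Y definable_Int by (simp add: rational_semimodule_iff_definable)
qed

lemma rational_relation_image:
  fixes X G :: "'a vec set"
  assumes "rational_semimodule n X" "rational_semimodule (n + p) G"
  shows "rational_semimodule p {v \<in> carrier_vec p. \<exists>x\<in>X. x @\<^sub>v v \<in> G}" (is "rational_semimodule p ?S")
proof -
  have X: "subsemimodule n X" "definable n X"
    and G: "subsemimodule (n + p) G" "definable (n + p) G"
    using assms by (simp_all add: rational_semimodule_iff_definable)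
  have "subsemimodule p ?S"
  proof (rule subsemimoduleI)
    have "0\<^sub>v n @\<^sub>v 0\<^sub>v p = (0\<^sub>v (n + p) :: 'a vec)" by (intro eq_vecI) auto
    then show "0\<^sub>v p \<in> ?S"
      using subsemimodule_zero[OF X(1)] subsemimodule_zero[OF G(1)]
      by (intro CollectI conjI bexI[of _ "0\<^sub>v n"]) auto
  next
    fix v w l m assume "v \<in> ?S" "w \<in> ?S"
    then obtain x y where v: "v \<in> carrier_vec p" "x \<in> X" "x @\<^sub>v v \<in> G"
      and w: "w \<in> carrier_vec p" "y \<in> X" "y @\<^sub>v w \<in> G" by blast
    have "x \<in> carrier_vec n" "y \<in> carrier_vec n"
      using v w definable_carrier[OF X(2)] by auto
    then have "(l \<cdot>\<^sub>v x + m \<cdot>\<^sub>v y) @\<^sub>v (l \<cdot>\<^sub>v v + m \<cdot>\<^sub>v w) \<in> G"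
      using subsemimodule_combination[OF G(1) v(3) w(3)] smult_add_append_vec[of x n y v p w] v w by simp
    then show "l \<cdot>\<^sub>v v + m \<cdot>\<^sub>v w \<in> ?S"
      using v w subsemimodule_combination[OF X(1) v(2) w(2)] by auto
  qed auto
  moreover have "fo_expressible (\<lambda>s. \<exists>x\<in>X. x @\<^sub>v vec p s \<in> G)"
    by (rule fo_bex[OF X(2)], rule fo_append_mem[OF G(2)])
  ultimately show ?thesis
    by (auto simp: rational_semimodule_iff_definable definable_iff_fo)
qed

lemma rational_relation_preimage:
  fixes Z G :: "'a vec set"
  assumes "rational_semimodule p Z" "rational_semimodule (n + p) G"
  shows "rational_semimodule n {u \<in> carrier_vec n. \<exists>z\<in>Z. u @\<^sub>v z \<in> G}" (is "rational_semimodule n ?S")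
proof -
  have Z: "subsemimodule p Z" "definable p Z"
    and G: "subsemimodule (n + p) G" "definable (n + p) G"
    using assms by (simp_all add: rational_semimodule_iff_definable)
  have "subsemimodule n ?S"
  proof (rule subsemimoduleI)
    have "0\<^sub>v n @\<^sub>v 0\<^sub>v p = (0\<^sub>v (n + p) :: 'a vec)" by (intro eq_vecI) auto
    then show "0\<^sub>v n \<in> ?S"
      using subsemimodule_zero[OF Z(1)] subsemimodule_zero[OF G(1)]
      by (intro CollectI conjI bexI[of _ "0\<^sub>v p"]) auto
  next
    fix v w l m assume "v \<in> ?S" "w \<in> ?S"
    then obtain x y where v: "v \<in> carrier_vec n" "x \<in> Z" "v @\<^sub>v x \<in> G"
      and w: "w \<in> carrier_vec n" "y \<in> Z" "w @\<^sub>v y \<in> G" by blast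
    have "x \<in> carrier_vec p" "y \<in> carrier_vec p"
      using v w definable_carrier[OF Z(2)] by auto
    then have "(l \<cdot>\<^sub>v v + m \<cdot>\<^sub>v w) @\<^sub>v (l \<cdot>\<^sub>v x + m \<cdot>\<^sub>v y) \<in> G"
      using subsemimodule_combination[OF G(1) v(3) w(3)] smult_add_append_vec[of v n w x p y] v w by simp
    then show "l \<cdot>\<^sub>v v + m \<cdot>\<^sub>v w \<in> ?S"
      using v w subsemimodule_combination[OF Z(1) v(2) w(2)] by auto
  qed auto
  moreover have "fo_expressible (\<lambda>s. \<exists>z\<in>Z. vec n s @\<^sub>v z \<in> G)"
    by (rule fo_bex[OF Z(2)], rule fo_append_mem[OF G(2)])
  ultimately show ?thesis
    by (auto simp: rational_semimodule_iff_definable definable_iff_fo)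
qed

lemma rational_graph:
  fixes A :: "'a vec \<Rightarrow> 'a vec"
  assumes A: "semimodule_hom n p A"
  shows "rational_semimodule (n + p) {x @\<^sub>v A x | x. x \<in> carrier_vec n}"
proof -
  have "A (basis_vec n j) \<in> carrier_vec p" for j
    using A unfolding semimodule_hom_def by auto
  then have "definable (n + p) ((\<lambda>j. basis_vec n j @\<^sub>v A (basis_vec n j)) ` {..<n})"
    by (intro definable_finite) auto
  then show ?thesis
    using subsemimodule_graph[OF A] definable_span
    by (simp add: rational_semimodule_iff_definable span_graph[OF A])
qed

lemma rational_hom_image:
  fixes X :: "'a vec set"
  assumes A: "semimodule_hom n p A" and X: "rational_semimodule n X"
  shows "rational_semimodule p (A ` X)"
proof -
  have X_carrier: "X \<subseteq> carrier_vec n"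
    using X unfolding rational_semimodule_def subsemimodule_def by blast
  then have "A ` X = {v \<in> carrier_vec p. \<exists>x\<in>X. x @\<^sub>v v \<in> {x @\<^sub>v A x | x. x \<in> carrier_vec n}}"
    using A by (auto simp: append_mem_graph_iff subset_iff semimodule_hom_def)
  then show ?thesis
    using rational_relation_image[OF X rational_graph[OF A]] by simp
qed

lemma rational_hom_preimage:
  fixes Z :: "'a vec set"
  assumes A: "semimodule_hom n p A" and Z: "rational_semimodule p Z"
  shows "rational_semimodule n {x \<in> carrier_vec n. A x \<in> Z}"
proof -
  have "{x \<in> carrier_vec n. A x \<in> Z}
      = {u \<in> carrier_vec n. \<exists>z\<in>Z. u @\<^sub>v z \<in> {x @\<^sub>v A x | x. x \<in> carrier_vec n}}"
    by (auto simp: append_mem_graph_iff)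
  then show ?thesis
    using rational_relation_preimage[OF Z rational_graph[OF A]] by simp
qed

lemma rational_difference:
  fixes X Y :: "'a vec set"
  assumes "rational_semimodule n X" "rational_semimodule n Y"
  shows "rational_semimodule n {u \<in> carrier_vec n. \<exists>y\<in>Y. u + y \<in> X}" (is "rational_semimodule n ?S")
proof -
  have X: "subsemimodule n X" "definable n X" and Y: "subsemimodule n Y" "definable n Y"
    using assms by (simp_all add: rational_semimodule_iff_definable)
  note carrier = definable_carrier[OF X(2)] definable_carrier[OF Y(2)]
  have "subsemimodule n ?S"
  proof (rule subsemimoduleI)
    show "0\<^sub>v n \<in> ?S"
      using subsemimodule_zero[OF X(1)] subsemimodule_zero[OF Y(1)] by force
  next
    fix u v l m assume "u \<in> ?S" "v \<in> ?S"
    then obtain y z where u: "u \<in> carrier_vec n" "y \<in> Y" "u + y \<in> X"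
      and v: "v \<in> carrier_vec n" "z \<in> Y" "v + z \<in> X" by blast
    have yz: "y \<in> carrier_vec n" "z \<in> carrier_vec n"
      using u v carrier by auto
    \<comment> \<open>The witness for a combination of \<open>u\<close> and \<open>v\<close> is the
      same combination of their witnesses \<open>y\<close> and \<open>z\<close>.\<close>
    have "(l \<cdot>\<^sub>v u + m \<cdot>\<^sub>v v) + (l \<cdot>\<^sub>v y + m \<cdot>\<^sub>v z) = l \<cdot>\<^sub>v (u + y) + m \<cdot>\<^sub>v (v + z)"
      using u v yz by (intro eq_vecI) (auto simp: distrib_left ac_simps)
    then have "(l \<cdot>\<^sub>v u + m \<cdot>\<^sub>v v) + (l \<cdot>\<^sub>v y + m \<cdot>\<^sub>v z) \<in> X"
      using subsemimodule_combination[OF X(1) u(3) v(3)] by simp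
    then show "l \<cdot>\<^sub>v u + m \<cdot>\<^sub>v v \<in> ?S"
      using u v subsemimodule_combination[OF Y(1) u(2) v(2)] by auto
  qed auto
  \<comment> \<open>The sum is not a term, so its value is quantified as an \<open>x\<close> in
    \<open>X\<close> and compared coordinatewise through \<open>fo_eq_add\<close>.\<close>
  moreover have "vec n s \<in> ?S \<longleftrightarrow> (\<exists>y\<in>Y. \<exists>x\<in>X. \<forall>i<n. x $ i = s i + y $ i)" for s
  proof -
    have "vec n s + y \<in> X \<longleftrightarrow> (\<exists>x\<in>X. \<forall>i<n. x $ i = s i + y $ i)" if "y \<in> Y" for y
    proof -
      have eq: "x = vec n s + y \<longleftrightarrow> (\<forall>i<n. x $ i = s i + y $ i)" if "x \<in> X" for x
      proof -
        have "dim_vec x = n" "dim_vec y = n"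
          using that \<open>y \<in> Y\<close> carrier by auto
        then show ?thesis by (simp add: vec_eq_iff)
      qed
      have "vec n s + y \<in> X \<longleftrightarrow> (\<exists>x\<in>X. x = vec n s + y)" by blast
      also have "\<dots> \<longleftrightarrow> (\<exists>x\<in>X. \<forall>i<n. x $ i = s i + y $ i)"
        using eq by (rule bex_cong[OF refl])
      finally show ?thesis .
    qed
    then show ?thesis by auto
  qed
  moreover have "fo_expressible (\<lambda>s. \<exists>y\<in>Y. \<exists>x\<in>X. \<forall>i<n. x $ i = s i + y $ i)"
    by (rule fo_bex[OF Y(2)], rule fo_bex[OF X(2)], rule fo_all_less) (simp add: fo_eq_add)
  ultimately show ?thesis
    by (auto simp: rational_semimodule_iff_definable definable_iff_fo)
qed

text \<open>Closure is linearity of the scalar product in \<open>x\<close>. The equations, possibly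
  infinitely many, become a single universally quantified formula because \<open>W\<close> is
  definable.\<close>

lemma rational_orthogonal_of_pairs:
  fixes W :: "'a vec set"
  assumes "rational_semimodule (n + n) W"
  shows "rational_semimodule n {x \<in> carrier_vec n.
    \<forall>a\<in>carrier_vec n. \<forall>b\<in>carrier_vec n. a @\<^sub>v b \<in> W \<longrightarrow> a \<bullet> x = b \<bullet> x}"
    (is "rational_semimodule n ?S")
proof -
  have W: "definable (n + n) W"
    using assms by (simp add: rational_semimodule_iff_definable)
  have "subsemimodule n ?S"
  proof (rule subsemimoduleI)
    fix x y l m assume "x \<in> ?S" "y \<in> ?S"
    then show "l \<cdot>\<^sub>v x + m \<cdot>\<^sub>v y \<in> ?S"
      by (auto simp: scalar_prod_add_distrib[of _ n])
  qed auto
  moreover have "fo_expressible (\<lambda>s. \<forall>a\<in>carrier_vec n. \<forall>b\<in>carrier_vec n.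
      a @\<^sub>v b \<in> W \<longrightarrow> a \<bullet> vec n s = b \<bullet> vec n s)"
    by (rule fo_ball[OF definable_carrier_vec], rule fo_ball[OF definable_carrier_vec],
        rule fo_imp[OF fo_append_mem[OF W] fo_scalar_prod_eq])
  ultimately show ?thesis
    by (auto simp: rational_semimodule_iff_definable definable_iff_fo)
qed

text \<open>Dual to the previous case: linearity is now used in the pair of coefficient vectors, and
  the quantifier ranges over \<open>X\<close>.\<close>

lemma rational_orthogonal_pairs:
  fixes X :: "'a vec set"
  assumes "rational_semimodule n X"
  shows "rational_semimodule (n + n) {a @\<^sub>v b | a b.
    a \<in> carrier_vec n \<and> b \<in> carrier_vec n \<and> (\<forall>x\<in>X. a \<bullet> x = b \<bullet> x)}"
    (is "rational_semimodule _ ?S")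
proof -
  have X: "definable n X"
    using assms by (simp add: rational_semimodule_iff_definable)
  note carrier = definable_carrier[OF X]
  have "subsemimodule (n + n) ?S"
  proof (rule subsemimoduleI)
    have "0\<^sub>v n @\<^sub>v 0\<^sub>v n = (0\<^sub>v (n + n) :: 'a vec)" by (intro eq_vecI) auto
    then show "0\<^sub>v (n + n) \<in> ?S"
      by (intro CollectI exI[of _ "0\<^sub>v n"]) auto
  next
    fix v w l m assume "v \<in> ?S" "w \<in> ?S"
    then obtain a b c d where v: "v = a @\<^sub>v b" "a \<in> carrier_vec n" "b \<in> carrier_vec n" "\<forall>x\<in>X. a \<bullet> x = b \<bullet> x"
      and w: "w = c @\<^sub>v d" "c \<in> carrier_vec n" "d \<in> carrier_vec n" "\<forall>x\<in>X. c \<bullet> x = d \<bullet> x" by blast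
    have "(l \<cdot>\<^sub>v a + m \<cdot>\<^sub>v c) \<bullet> x = (l \<cdot>\<^sub>v b + m \<cdot>\<^sub>v d) \<bullet> x" if "x \<in> X" for x
      using that v w carrier by (auto simp: add_scalar_prod_distrib[of _ n])
    moreover have "l \<cdot>\<^sub>v v + m \<cdot>\<^sub>v w = (l \<cdot>\<^sub>v a + m \<cdot>\<^sub>v c) @\<^sub>v (l \<cdot>\<^sub>v b + m \<cdot>\<^sub>v d)"
      using v w by (simp add: smult_add_append_vec)
    ultimately show "l \<cdot>\<^sub>v v + m \<cdot>\<^sub>v w \<in> ?S"
      using v w
      by (intro CollectI exI[of _ "l \<cdot>\<^sub>v a + m \<cdot>\<^sub>v c"] exI[of _ "l \<cdot>\<^sub>v b + m \<cdot>\<^sub>v d"]) simp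
  qed auto
  moreover have "vec (n + n) s \<in> ?S \<longleftrightarrow> (\<forall>x\<in>X. vec n s \<bullet> x = vec n (\<lambda>i. s (i + n)) \<bullet> x)" for s
  proof -
    have split: "vec (n + n) s = vec n s @\<^sub>v vec n (\<lambda>i. s (i + n))"
      by (intro eq_vecI) auto
    have "vec n s = a \<and> vec n (\<lambda>i. s (i + n)) = b" if "vec (n + n) s = a @\<^sub>v b" "a \<in> carrier_vec n" for a b
      using that append_vec_eq[of "vec n s" n a] unfolding split by simp
    then show ?thesis using split by (auto 4 4)
  qed
  moreover have "fo_expressible (\<lambda>s. \<forall>x\<in>X. vec n s \<bullet> x = vec n (\<lambda>i. s (i + n)) \<bullet> x)"
    by (rule fo_ball[OF X], rule fo_scalar_prod_eq)
  ultimately show ?thesis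
    by (auto simp: rational_semimodule_iff_definable definable_iff_fo)
qed

end

end

end

theorem theorem3p5:
  fixes X Y Z G W :: "'a::{comm_semiring_0,comm_monoid_mult} vec set"
    and A :: "'a vec \<Rightarrow> 'a vec"
    and n p :: nat
  assumes idempotent: "\<And>x::'a. x + x = x"
    and presburger: "presburger_property TYPE('a)"
    and total_order: "\<And>x y::'a. x \<preceq> y \<or> y \<preceq> x"
    and X: "rational_semimodule n X"
    and Y: "rational_semimodule n Y"
    and Z: "rational_semimodule p Z"
    and G: "rational_semimodule (n + p) G"
    and W: "rational_semimodule (2 * n) W"
    and A: "semimodule_hom n p A"
  shows "rational_semimodule n (X \<inter> Y)
    \<and> rational_semimodule p {v \<in> carrier_vec p. \<exists>x\<in>X. x @\<^sub>v v \<in> G}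
    \<and> rational_semimodule n {u \<in> carrier_vec n. \<exists>z\<in>Z. u @\<^sub>v z \<in> G}
    \<and> rational_semimodule p (A ` X)
    \<and> rational_semimodule n {x \<in> carrier_vec n. A x \<in> Z}
    \<and> rational_semimodule n {u \<in> carrier_vec n. \<exists>y\<in>Y. u + y \<in> X}
    \<and> rational_semimodule n {x \<in> carrier_vec n.
        \<forall>a\<in>carrier_vec n. \<forall>b\<in>carrier_vec n. a @\<^sub>v b \<in> W \<longrightarrow> a \<bullet> x = b \<bullet> x}
    \<and> rational_semimodule (2 * n) {a @\<^sub>v b | a b.
        a \<in> carrier_vec n \<and> b \<in> carrier_vec n \<and> (\<forall>x\<in>X. a \<bullet> x = b \<bullet> x)}"
  using rational_Int[OF idempotent total_order presburger X Y]
    rational_relation_image[OF idempotent total_order presburger X G]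
    rational_relation_preimage[OF idempotent total_order presburger Z G]
    rational_hom_image[OF idempotent total_order presburger A X]
    rational_hom_preimage[OF idempotent total_order presburger A Z]
    rational_difference[OF idempotent total_order presburger X Y]
    rational_orthogonal_of_pairs[OF idempotent total_order presburger W[unfolded mult_2]]
    rational_orthogonal_pairs[OF idempotent total_order presburger X]
  unfolding mult_2 by (intro conjI)

end
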